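(* Let $w_1,\dots,w_d,u>0$ be real numbers, $n\in\mathbb{N}$, and $\mathbf{z}=(z_1,\dots,z_d)\in\mathbb{Z}^d$. Let $\Lambda=\mathcal{S}_{\mathbf{w},u}=\{\mathbf{h}\in\mathbb{N}_0^d:\sum_{j=1}^d w_jh_j\le u\}$. The following are equivalent: (i) $(n,\mathbf{z})$ is admissible for Plan A for $\Lambda$; (ii) all three of the following hold: (a) $(n,\mathbf{z})$ is admissible for Plan C for $\Lambda$; (b) $2\lfloor u/w_j\rfloor z_j\not\equiv_n0$ for every $j\in\{1,\dots,d\}$ such that $u\ge w_j$; (c) $\mathbf{h}'\cdot\mathbf{z}\not\equiv_n\mathbf{h}\cdot\mathbf{z}$ for all $\mathbf{h}'\ne\mathbf{h}\in\mathcal{M}(\Lambda)$ with $\|\mathbf{h}\|_{\mathbf{w},\ell_1}+\|\mathbf{h}'\|_{\mathbf{w},\ell_1}>2u-\alpha_{\mathbf{h},\mathbf{h}'}$. If $n$ is odd, condition (b) is implied by condition (a).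
   Context: $\mathbb{N}=\{1,2,\dots\}$, $\mathbb{N}_0=\mathbb{N}\cup\{0\}$; $a\equiv_n b$ means $a\equiv b\pmod n$. The weighted norm is $\|\mathbf{x}\|_{\mathbf{w},\ell_1}=\sum_{j=1}^d w_j|x_j|$ for $\mathbf{x}\in\mathbb{R}^d$. The support $\mathrm{supp}(\mathbf{h})$ is the set of $j$ with $h_j\ne0$, and $\alpha_{\mathbf{h},\mathbf{h}'}=\max\{w_i: i\in\mathrm{supp}(\mathbf{h})\cup\mathrm{supp}(\mathbf{h}')\}$. For $\mathbf{h}\in\mathbb{N}_0^d$, $\mathcal{S}_{\mathbf{h}}$ is the set of the $2^{|\mathbf{h}|_0}$ component-wise sign changes acting on the nonzero coordinates of $\mathbf{h}$ (including the identity), where $|\mathbf{h}|_0=\#\mathrm{supp}(\mathbf{h})$. The mirrored set of $\Lambda\subset\mathbb{N}_0^d$ is $\mathcal{M}(\Lambda)=\{\sigma(\mathbf{h}):\mathbf{h}\in\Lambda,\ \sigma\in\mathcal{S}_{\mathbf{h}}\}$. A pair $(n,\mathbf{z})\in\mathbb{N}\times\mathbb{Z}^d$ is, for $\Lambda$: - admissible for Plan A if $\mathbf{h}\cdot\mathbf{z}\not\equiv_n\mathbf{h}'\cdot\mathbf{z}$ for all $\mathbf{h}\ne\mathbf{h}'\in\mathcal{M}(\Lambda)$; - admissible for Plan C if $\sigma(\mathbf{h})\cdot\mathbf{z}\not\equiv_n\mathbf{h}'\cdot\mathbf{z}$ for all $\mathbf{h},\mathbf{h}'\in\Lambda$ and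 $\sigma\in\mathcal{S}_{\mathbf{h}}$ with $\mathbf{h}\ne\mathbf{h}'$. *)

theory Defs
  imports "HOL-Analysis.Analysis" "HOL-Number_Theory.Number_Theory"
begin

definition int_vec :: "nat ^ 'd \<Rightarrow> int ^ 'd" where
  "int_vec h = (\<chi> j. int (h $ j))"

definition real_vec :: "int ^ 'd \<Rightarrow> real ^ 'd" where
  "real_vec h = (\<chi> j. real_of_int (h $ j))"

definition dot :: "int ^ 'd \<Rightarrow> int ^ 'd \<Rightarrow> int" where
  "dot h z = (\<Sum>j\<in>UNIV. h $ j * z $ j)"

definition supp :: "('a :: zero) ^ 'd \<Rightarrow> 'd set" where
  "supp h = {j. h $ j \<noteq> 0}"

definition weighted_l1_norm :: "real ^ 'd \<Rightarrow> real ^ 'd \<Rightarrow> real" where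
  "weighted_l1_norm w x = (\<Sum>j\<in>UNIV. w $ j * \<bar>x $ j\<bar>)"

text \<open>The value is unspecified when both vectors are zero.\<close>

definition max_weight :: "real ^ 'd \<Rightarrow> int ^ 'd \<Rightarrow> int ^ 'd \<Rightarrow> real" where
  "max_weight w h h' = Max ((\<lambda>i. w $ i) ` (supp h \<union> supp h'))"

definition weighted_simplex :: "real ^ 'd \<Rightarrow> real \<Rightarrow> (nat ^ 'd) set" where
  "weighted_simplex w u = {h. (\<Sum>j\<in>UNIV. w $ j * real (h $ j)) \<le> u}"

text \<open>
  A sign change is determined by the set \<open>J\<close> of nonzero coordinates of \<open>h\<close> that it negates;
  \<open>J = {}\<close> is the identity, that is, the embedding \<^const>\<open>int_vec\<close>.
\<close>

definition sign_changes :: "nat ^ 'd \<Rightarrow> (nat ^ 'd \<Rightarrow> int ^ 'd) set" where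
  "sign_changes h =
     {\<sigma>. \<exists>J \<subseteq> supp h. \<sigma> = (\<lambda>x. \<chi> j. if j \<in> J then - int (x $ j) else int (x $ j))}"

lemma int_vec_in_sign_changes: "int_vec \<in> sign_changes h"
  unfolding sign_changes_def int_vec_def by (auto simp: fun_eq_iff intro!: exI[of _ "{}"])

lemma card_sign_changes:
  fixes h :: "nat ^ 'd"
  shows "card (sign_changes h) = 2 ^ card (supp h)"
proof -
  let ?f = "\<lambda>J (x :: nat ^ 'd). (\<chi> j. if j \<in> J then - int (x $ j) else int (x $ j)) :: int ^ 'd"
  have "inj_on ?f (Pow (supp h))"
  proof (rule inj_onI)
    fix J K assume "?f J = ?f K"
    then have "?f J (\<chi> j. 1) $ j = ?f K (\<chi> j. 1) $ j" for j
      by metis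
    then show "J = K"
      by (force split: if_splits)
  qed
  moreover have "sign_changes h = ?f ` Pow (supp h)"
    unfolding sign_changes_def by auto
  ultimately show ?thesis
    by (simp add: card_image card_Pow)
qed

definition mirrored :: "(nat ^ 'd) set \<Rightarrow> (int ^ 'd) set" where
  "mirrored \<Lambda> = {\<sigma> h | h \<sigma>. h \<in> \<Lambda> \<and> \<sigma> \<in> sign_changes h}"

definition admissible_plan_A :: "nat \<Rightarrow> int ^ 'd \<Rightarrow> (nat ^ 'd) set \<Rightarrow> bool" where
  "admissible_plan_A n z \<Lambda> \<longleftrightarrow>
     (\<forall>h \<in> mirrored \<Lambda>. \<forall>h' \<in> mirrored \<Lambda>. h \<noteq> h' \<longrightarrow> \<not> [dot h z = dot h' z] (mod int n))"

definition admissible_plan_C :: "nat \<Rightarrow> int ^ 'd \<Rightarrow> (nat ^ 'd) set \<Rightarrow> bool" where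
  "admissible_plan_C n z \<Lambda> \<longleftrightarrow>
     (\<forall>h \<in> \<Lambda>. \<forall>h' \<in> \<Lambda>. \<forall>\<sigma> \<in> sign_changes h.
        h \<noteq> h' \<longrightarrow> \<not> [dot (\<sigma> h) z = dot (int_vec h') z] (mod int n))"

end

theory Submission
  imports Defs
begin

text \<open>
  The mirrored simplex is the ball of radius \<open>u\<close> of the weighted norm in the integer lattice, so
  failure of Plan A means that \<open>v \<cdot> z \<equiv> 0\<close> for a difference \<open>v \<noteq> 0\<close> of two points of this ball.
  Condition (c) covers the pairs of large total norm; otherwise
  \<open>\<parallel>v\<parallel> + \<alpha> \<le> 2 u\<close>. Since no unit step inside the support of \<open>v\<close> is longer than \<open>\<alpha>\<close>, removing units
  one at a time from the negative part of \<open>v\<close> (or of \<open>- v\<close>) gives \<open>q \<ge> 0\<close> with both \<open>q\<close> and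
  \<open>v + q\<close> in the ball, and Plan C applies to this pair unless \<open>v = - 2 q\<close>. In that case the split
  \<open>2 q = (q + e) + (q - e)\<close> is used for a small \<open>e \<noteq> 0\<close>, namely a unit vector or a difference of two
  unit vectors; such an \<open>e\<close> fails to exist only if \<open>q\<close> is the longest multiple of a single unit
  vector in the ball, which is condition (b).
\<close>

section \<open>Weighted norm and dot product on integer vectors\<close>

abbreviation lattice_norm :: "real ^ 'd \<Rightarrow> int ^ 'd \<Rightarrow> real" where
  "lattice_norm w x \<equiv> weighted_l1_norm w (real_vec x)"

lemma lattice_norm_eq: "lattice_norm w x = (\<Sum>j\<in>UNIV. w $ j * real_of_int \<bar>x $ j\<bar>)"
  by (simp add: weighted_l1_norm_def real_vec_def)

lemma lattice_norm_minus [simp]: "lattice_norm w (- x) = lattice_norm w x"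
  by (simp add: lattice_norm_eq)

text \<open>The assumption says that no coordinate has opposite signs in \<open>x\<close> and
  \<open>y\<close>, which is the equality case of the triangle inequality.\<close>

lemma lattice_norm_add:
  assumes "\<And>j. \<bar>x $ j + y $ j\<bar> = \<bar>x $ j\<bar> + \<bar>y $ j\<bar>"
  shows "lattice_norm w (x + y) = lattice_norm w x + lattice_norm w y"
  by (simp only: lattice_norm_eq vector_add_component assms of_int_add distrib_left sum.distrib)

lemma lattice_norm_triangle:
  assumes "\<And>j. w $ j > 0"
  shows "lattice_norm w (x - y) \<le> lattice_norm w x + lattice_norm w y"
  unfolding lattice_norm_eq sum.distrib [symmetric] distrib_left [symmetric] of_int_add [symmetric]
  using assms by (intro sum_mono mult_left_mono) (auto simp: less_imp_le)

lemma lattice_norm_axis: "lattice_norm w (axis i m) = w $ i * real_of_int \<bar>m\<bar>"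
proof -
  have "lattice_norm w (axis i m) = (\<Sum>j\<in>UNIV. if j = i then w $ j * real_of_int \<bar>m\<bar> else 0)"
    unfolding lattice_norm_eq by (rule sum.cong) (auto simp: axis_def)
  then show ?thesis by simp
qed

lemma lattice_norm_diff_axis:
  assumes "\<And>j. 0 \<le> x $ j" and "i \<in> supp x"
  shows "lattice_norm w (x - axis i 1) = lattice_norm w x - w $ i"
proof -
  have "x $ i \<ge> 1"
    using assms(1) [of i] assms(2) by (simp add: supp_def)
  then have "lattice_norm w ((x - axis i 1) + axis i 1)
      = lattice_norm w (x - axis i 1) + lattice_norm w (axis i 1)"
    using assms(1) by (intro lattice_norm_add) (auto simp: axis_def)
  then show ?thesis by (simp add: lattice_norm_axis)
qed

lemma lattice_norm_add_axis:
  assumes "\<And>j. 0 \<le> x $ j"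
  shows "lattice_norm w (x + axis i 1) = lattice_norm w x + w $ i"
proof -
  have "lattice_norm w (x + axis i 1) = lattice_norm w x + lattice_norm w (axis i 1)"
    using assms by (intro lattice_norm_add) (auto simp: axis_def)
  then show ?thesis by (simp add: lattice_norm_axis)
qed

lemma dot_add: "dot (x + y) z = dot x z + dot y z"
  by (simp add: dot_def distrib_right sum.distrib)

lemma dot_minus: "dot (- x) z = - dot x z"
  by (simp add: dot_def sum_negf)

lemma dot_diff: "dot (x - y) z = dot x z - dot y z"
  by (simp add: dot_def left_diff_distrib sum_subtractf)

lemma dot_axis: "dot (axis i m) z = m * z $ i"
proof -
  have "dot (axis i m) z = (\<Sum>j\<in>UNIV. if j = i then m * z $ j else 0)"
    unfolding dot_def by (rule sum.cong) (auto simp: axis_def)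
  then show ?thesis by simp
qed

lemma supp_diff_subset:
  fixes x y :: "int ^ 'd"
  shows "supp (x - y) \<subseteq> supp x \<union> supp y"
  by (auto simp: supp_def)

section \<open>Sign changes, the mirrored simplex and Plan C in terms of the norm\<close>

lemma exists_sign_change:
  fixes x :: "int ^ 'd"
  shows "\<exists>\<sigma> \<in> sign_changes (\<chi> j. nat \<bar>x $ j\<bar>). \<sigma> (\<chi> j. nat \<bar>x $ j\<bar>) = x"
proof -
  let ?h = "\<chi> j. nat \<bar>x $ j\<bar>"
  let ?J = "{j. x $ j < 0}"
  let ?\<sigma> = "\<lambda>h. \<chi> j. if j \<in> ?J then - int (h $ j) else int (h $ j)"
  have "?J \<subseteq> supp ?h"
    by (auto simp: supp_def)
  then have "?\<sigma> \<in> sign_changes ?h"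
    unfolding sign_changes_def by blast
  moreover have "?\<sigma> ?h = x"
    by (simp add: vec_eq_iff)
  ultimately show ?thesis by (intro bexI [of _ ?\<sigma>])
qed

lemma abs_sign_change:
  assumes "\<sigma> \<in> sign_changes h"
  shows "\<bar>\<sigma> x $ j\<bar> = int (x $ j)"
  using assms by (auto simp: sign_changes_def)

lemma nat_abs_in_weighted_simplex:
  assumes "lattice_norm w x \<le> u"
  shows "(\<chi> j. nat \<bar>x $ j\<bar>) \<in> weighted_simplex w u"
  using assms by (simp add: lattice_norm_eq weighted_simplex_def)

lemma mirrored_weighted_simplex:
  "mirrored (weighted_simplex w u) = {x. lattice_norm w x \<le> u}"
proof (intro equalityI subsetI)
  fix x assume "x \<in> mirrored (weighted_simplex w u)"
  then obtain h \<sigma> where "x = \<sigma> h" "h \<in> weighted_simplex w u" "\<sigma> \<in> sign_changes h"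
    unfolding mirrored_def by blast
  then show "x \<in> {x. lattice_norm w x \<le> u}"
    by (simp add: weighted_simplex_def lattice_norm_eq abs_sign_change del: of_int_abs)
next
  fix x assume "x \<in> {x. lattice_norm w x \<le> u}"
  then have "(\<chi> j. nat \<bar>x $ j\<bar>) \<in> weighted_simplex w u"
    by (simp add: nat_abs_in_weighted_simplex)
  moreover obtain \<sigma> where "\<sigma> \<in> sign_changes (\<chi> j. nat \<bar>x $ j\<bar>)" "\<sigma> (\<chi> j. nat \<bar>x $ j\<bar>) = x"
    using exists_sign_change [of x] by blast
  ultimately show "x \<in> mirrored (weighted_simplex w u)"
    unfolding mirrored_def by (metis (mono_tags, lifting) mem_Collect_eq)
qed

text \<open>Plan C freed of sign changes: \<open>x\<close> is a sign change of its vector of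
  absolute values, \<open>y\<close> equals its own, and \<open>ne\<close> makes these two points of
  the simplex distinct.\<close>

lemma plan_C_not_dvd:
  assumes C: "admissible_plan_C n z (weighted_simplex w u)"
    and x: "lattice_norm w x \<le> u" and y: "lattice_norm w y \<le> u"
    and nonneg: "\<And>j. 0 \<le> y $ j" and ne: "\<bar>x $ i\<bar> \<noteq> y $ i"
  shows "\<not> int n dvd dot (x - y) z"
proof -
  let ?h = "\<chi> j. nat \<bar>x $ j\<bar>" and ?k = "\<chi> j. nat \<bar>y $ j\<bar>"
  obtain \<sigma> where \<sigma>: "\<sigma> \<in> sign_changes ?h" "\<sigma> ?h = x"
    using exists_sign_change [of x] by blast
  have "?h \<noteq> ?k"
  proof
    assume "?h = ?k"
    then have "nat \<bar>x $ i\<bar> = nat \<bar>y $ i\<bar>"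
      by (simp add: vec_eq_iff)
    with ne nonneg [of i] show False by simp
  qed
  moreover have "int_vec ?k = y"
    using nonneg by (simp add: int_vec_def vec_eq_iff)
  ultimately have "\<not> [dot x z = dot y z] (mod int n)"
    using C \<sigma> nat_abs_in_weighted_simplex [OF x] nat_abs_in_weighted_simplex [OF y]
    unfolding admissible_plan_C_def by metis
  then show ?thesis
    by (simp add: cong_iff_dvd_diff dot_diff)
qed

section \<open>Difference vectors of small norm\<close>

text \<open>A discrete intermediate value argument: units are removed until the norm first drops to
  at most \<open>u\<close>. No single step exceeds \<alpha>, so it cannot jump over the window from
  \<open>l\<close> to \<open>u\<close>.\<close>

lemma intermediate_norm:
  fixes w :: "real ^ 'd" and p :: "int ^ 'd"
  assumes "\<And>j. w $ j > 0" and "\<And>j. 0 \<le> p $ j" and "\<And>j. j \<in> supp p \<Longrightarrow> w $ j \<le> \<alpha>"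
    and "l \<le> lattice_norm w p" and "l + \<alpha> \<le> u" and "0 \<le> u"
  shows "\<exists>q. (\<forall>j. 0 \<le> q $ j \<and> q $ j \<le> p $ j) \<and> l \<le> lattice_norm w q \<and> lattice_norm w q \<le> u"
  using assms(2-4)
proof (induction "nat (\<Sum>j\<in>UNIV. p $ j)" arbitrary: p rule: less_induct)
  case less
  show ?case
  proof (cases "lattice_norm w p \<le> u")
    case True
    with less.prems show ?thesis by blast
  next
    case False
    with assms(6) have "p \<noteq> 0"
      by (auto simp: lattice_norm_eq)
    then obtain i where i: "i \<in> supp p"
      by (auto simp: supp_def vec_eq_iff)
    then have pi: "p $ i \<ge> 1"
      using less.prems(1) [of i] by (simp add: supp_def)
    let ?p = "p - axis i 1"
    have nonneg: "0 \<le> ?p $ j" for j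
      using less.prems(1) [of j] pi by (auto simp: axis_def)
    have "(\<Sum>j\<in>UNIV. ?p $ j) = (\<Sum>j\<in>UNIV. p $ j) - 1"
      by (simp add: sum_subtractf axis_def)
    moreover have "(\<Sum>j\<in>UNIV. ?p $ j) \<ge> 0"
      using nonneg by (rule sum_nonneg)
    ultimately have "nat (\<Sum>j\<in>UNIV. ?p $ j) < nat (\<Sum>j\<in>UNIV. p $ j)"
      by linarith
    moreover have "w $ j \<le> \<alpha>" if "j \<in> supp ?p" for j
      using less.prems(2) [of j] less.prems(2) [OF i] that
      by (cases "j = i") (auto simp: supp_def axis_def)
    \<comment> \<open>The norm of \<open>p\<close> still exceeds \<open>u\<close>, and the removed
      unit costs at most \<alpha>, so more than \<open>u - \<alpha> \<ge> l\<close> remains.\<close>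
    moreover have "l \<le> lattice_norm w ?p"
      using False assms(5) less.prems(2) [OF i] lattice_norm_diff_axis [OF less.prems(1) i, of w]
      by linarith
    ultimately obtain q where q: "\<forall>j. 0 \<le> q $ j \<and> q $ j \<le> ?p $ j"
      "l \<le> lattice_norm w q" "lattice_norm w q \<le> u"
      using less.hyps [of ?p] nonneg by blast
    have "?p $ j \<le> p $ j" for j
      by (simp add: axis_def)
    with q show ?thesis
      by (meson order_trans)
  qed
qed

text \<open>Plan C is applied to \<open>- (q - e)\<close> and \<open>q + e\<close>, whose difference
  is \<open>- 2 q\<close>. Their absolute values differ wherever \<open>e\<close> is
  nonzero.\<close>

lemma plan_C_balanced_split:
  assumes C: "admissible_plan_C n z (weighted_simplex w u)"
    and nonneg: "\<And>j. 0 \<le> (q + e) $ j" "\<And>j. 0 \<le> (q - e) $ j"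
    and norm: "lattice_norm w (q + e) \<le> u" "lattice_norm w (q - e) \<le> u"
    and "e \<noteq> 0"
  shows "\<not> int n dvd 2 * dot q z"
proof -
  obtain i where "e $ i \<noteq> 0"
    using \<open>e \<noteq> 0\<close> by (auto simp: vec_eq_iff)
  then have "\<bar>(- (q - e)) $ i\<bar> \<noteq> (q + e) $ i"
    using nonneg(2) [of i] by simp
  then have "\<not> int n dvd dot (- (q - e) - (q + e)) z"
    using norm by (intro plan_C_not_dvd [OF C _ _ nonneg(1)]) (simp_all only: lattice_norm_minus)
  moreover have "dot (- (q - e) - (q + e)) z = - (2 * dot q z)"
    unfolding dot_diff dot_minus dot_add by simp
  ultimately show ?thesis by simp
qed

lemma not_dvd_twice:
  fixes w :: "real ^ 'd"
  assumes w: "\<And>j. w $ j > 0"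
    and C: "admissible_plan_C n z (weighted_simplex w u)"
    and B: "\<And>j. u \<ge> w $ j \<Longrightarrow> \<not> int n dvd 2 * \<lfloor>u / w $ j\<rfloor> * z $ j"
    and nonneg: "\<And>j. 0 \<le> q $ j" and "q \<noteq> 0"
    and \<alpha>: "\<And>j. j \<in> supp q \<Longrightarrow> w $ j \<le> \<alpha>"
    and norm: "2 * lattice_norm w q + \<alpha> \<le> 2 * u"
  shows "\<not> int n dvd 2 * dot q z"
proof -
  obtain i where i: "i \<in> supp q"
    using \<open>q \<noteq> 0\<close> by (auto simp: supp_def vec_eq_iff)
  have pos: "q $ j \<ge> 1" if "j \<in> supp q" for j
    using nonneg [of j] that by (simp add: supp_def)
  \<comment> \<open>Either some unit step in the support stays in the ball, or none does; then
    \<open>q\<close> has a second support coordinate to trade units with, or it lies on an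
    axis.\<close>
  consider (step) j where "j \<in> supp q" "lattice_norm w q + w $ j \<le> u"
    | (swap) j where "j \<in> supp q" "j \<noteq> i" "lattice_norm w q + w $ i > u" "lattice_norm w q + w $ j > u"
    | (axis) "supp q = {i}" "lattice_norm w q + w $ i > u"
    using i by (metis insertI1 linorder_not_le singletonD subsetI subset_singletonD empty_iff)
  then show ?thesis
  proof cases
    case step
    show ?thesis
    proof (rule plan_C_balanced_split [OF C, where e = "axis j 1"])
      show "0 \<le> (q + axis j 1) $ k" "0 \<le> (q - axis j 1) $ k" for k
        using nonneg [of k] pos [OF step(1)] by (auto simp: axis_def)
      show "lattice_norm w (q + axis j 1) \<le> u"
        using step lattice_norm_add_axis [OF nonneg] by simp
      show "lattice_norm w (q - axis j 1) \<le> u"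
        using step lattice_norm_diff_axis [OF nonneg step(1), of w] w [of j] by linarith
    qed (simp add: axis_eq_0_iff)
  next
    case swap
    let ?e = "axis i 1 - axis j 1 :: int ^ 'd"
    have e: "(q + ?e) = (q - axis j 1) + axis i 1" "(q - ?e) = (q - axis i 1) + axis j 1"
      by simp_all
    have nn: "0 \<le> (q - axis k 1) $ l" if "k \<in> supp q" for k l
      using nonneg [of l] pos [OF that] by (auto simp: axis_def)
    have "lattice_norm w (q + ?e) = lattice_norm w q - w $ j + w $ i"
      "lattice_norm w (q - ?e) = lattice_norm w q - w $ i + w $ j"
      unfolding e using i swap(1)
      by (simp_all only: lattice_norm_add_axis [OF nn] lattice_norm_diff_axis [OF nonneg])
    \<comment> \<open>Both weights lie between \<open>u - \<parallel>q\<parallel> \<ge> \<alpha> / 2\<close> and \<open>\<alpha>\<close>, so they differ by at most \<open>\<alpha> / 2\<close>.\<close>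
    then have "lattice_norm w (q + ?e) \<le> u" "lattice_norm w (q - ?e) \<le> u"
      using swap \<alpha> [OF i] \<alpha> [OF swap(1)] norm by linarith+
    moreover have "?e \<noteq> 0"
      using swap(2) by (auto simp: axis_def vec_eq_iff)
    moreover have "0 \<le> (q + ?e) $ k" "0 \<le> (q - ?e) $ k" for k
      using nonneg [of k] pos [OF i] pos [OF swap(1)] by (auto simp: axis_def)
    ultimately show ?thesis
      by (intro plan_C_balanced_split [OF C])
  next
    case axis
    have q: "q = axis i (q $ i)"
      using axis(1) by (auto simp: vec_eq_iff axis_def supp_def)
    have norm_q: "lattice_norm w q = w $ i * real_of_int (q $ i)"
      using lattice_norm_axis [of w i "q $ i"] q nonneg [of i] by simp
    have "\<alpha> > 0"
      using \<alpha> [OF i] w [of i] by linarith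
    then have le: "w $ i * real_of_int (q $ i) \<le> u"
      using norm norm_q by linarith
    \<comment> \<open>\<open>q\<close> lies in the ball but one more unit leaves it, so
      \<open>q\<close> is exactly the point to which condition (b) refers.\<close>
    have "\<lfloor>u / w $ i\<rfloor> = q $ i"
      using le axis(2) norm_q w [of i]
      by (intro floor_unique) (simp_all add: field_simps)
    moreover have "w $ i \<le> u"
    proof -
      have "w $ i * 1 \<le> w $ i * real_of_int (q $ i)"
        using w [of i] pos [OF i] by (intro mult_left_mono) auto
      with le show ?thesis by linarith
    qed
    moreover have "dot q z = q $ i * z $ i"
      using dot_axis [of i "q $ i" z] q by simp
    ultimately show ?thesis
      using B [of i] by (simp add: mult.assoc)
  qed
qed

text \<open>With \<open>v = (v + q) - q\<close> and \<open>0 \<le> q\<close> below the negative part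
  of \<open>v\<close>, the norms of \<open>v + q\<close> and \<open>q\<close> add up to that of
  \<open>v\<close>. Both points are thus in the ball iff the norm of \<open>q\<close> lies between
  \<open>lattice_norm w v - u\<close> and \<open>u\<close>, a window of length at least \<alpha> by
  \<open>norm\<close>.\<close>

lemma not_dvd_of_large_negative_part:
  fixes w :: "real ^ 'd" and v :: "int ^ 'd"
  assumes w: "\<And>j. w $ j > 0" and "u > 0"
    and C: "admissible_plan_C n z (weighted_simplex w u)"
    and B: "\<And>j. u \<ge> w $ j \<Longrightarrow> \<not> int n dvd 2 * \<lfloor>u / w $ j\<rfloor> * z $ j"
    and "v \<noteq> 0"
    and \<alpha>: "\<And>j. j \<in> supp v \<Longrightarrow> w $ j \<le> \<alpha>"
    and norm: "lattice_norm w v + \<alpha> \<le> 2 * u"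
    and neg: "lattice_norm w v - u \<le> lattice_norm w (\<chi> j. max 0 (- v $ j))"
  shows "\<not> int n dvd dot v z"
proof -
  let ?p = "(\<chi> j. max 0 (- v $ j)) :: int ^ 'd"
  have "\<exists>q. (\<forall>j. 0 \<le> q $ j \<and> q $ j \<le> ?p $ j)
      \<and> lattice_norm w v - u \<le> lattice_norm w q \<and> lattice_norm w q \<le> u"
  proof (rule intermediate_norm [OF w _ _ neg])
    show "w $ j \<le> \<alpha>" if "j \<in> supp ?p" for j
      using that by (intro \<alpha>) (auto simp: supp_def)
  qed (use norm \<open>u > 0\<close> in auto)
  then obtain q where q: "\<And>j. 0 \<le> q $ j" "\<And>j. q $ j \<le> max 0 (- v $ j)"
    "lattice_norm w v - u \<le> lattice_norm w q" "lattice_norm w q \<le> u"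
    by auto
  have "lattice_norm w ((v + q) + (- q)) = lattice_norm w (v + q) + lattice_norm w (- q)"
  proof (rule lattice_norm_add)
    show "\<bar>(v + q) $ j + (- q) $ j\<bar> = \<bar>(v + q) $ j\<bar> + \<bar>(- q) $ j\<bar>" for j
      using q(1,2) [of j] by (auto simp: max_def split: if_splits)
  qed
  then have vq: "lattice_norm w (v + q) = lattice_norm w v - lattice_norm w q"
    by simp
  show ?thesis
  proof (cases "\<exists>i. \<bar>(v + q) $ i\<bar> \<noteq> q $ i")
    case True
    then obtain i where "\<bar>(v + q) $ i\<bar> \<noteq> q $ i" ..
    then have "\<not> int n dvd dot (v + q - q) z"
      using q vq by (intro plan_C_not_dvd [OF C _ _ q(1)]) simp_all
    then show ?thesis by simp
  next
    case False
    \<comment> \<open>Where \<open>v $ j \<ge> 0\<close>, \<open>q $ j\<close> vanishes and hence so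
      does \<open>v $ j\<close>; elsewhere \<open>v $ j + q $ j \<le> 0\<close>, so its absolute
      value is \<open>- v $ j - q $ j\<close>.\<close>
    have v_eq: "v $ j = - (q $ j) - q $ j" for j
    proof -
      have "\<bar>v $ j + q $ j\<bar> = q $ j"
        using False by simp
      then show ?thesis
        using q(1,2) [of j] by (auto simp: max_def split: if_splits)
    qed
    then have v: "v = - q - q"
      by (simp add: vec_eq_iff)
    have "\<not> int n dvd 2 * dot q z"
    proof (rule not_dvd_twice [OF w C B q(1)])
      show "q \<noteq> 0"
        using v \<open>v \<noteq> 0\<close> by auto
      show "w $ j \<le> \<alpha>" if "j \<in> supp q" for j
        using that v_eq [of j] by (intro \<alpha>) (auto simp: supp_def)
      have "lattice_norm w (v + q) = lattice_norm w q"
        using lattice_norm_minus [of w q] by (simp add: v del: lattice_norm_minus)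
      then show "2 * lattice_norm w q + \<alpha> \<le> 2 * u"
        using vq norm by linarith
    qed
    moreover have "dot v z = - (2 * dot q z)"
      unfolding v dot_diff dot_minus by simp
    ultimately show ?thesis by simp
  qed
qed

text \<open>The norms of the negative and positive parts add up to that of \<open>v\<close>, so one
  of them is at least half of it. Since \<open>lattice_norm w v < 2 * u\<close>, this half is at
  least \<open>lattice_norm w v - u\<close>; passing to \<open>- v\<close> exchanges the
  parts.\<close>

lemma not_dvd_of_small_norm:
  fixes w :: "real ^ 'd" and v :: "int ^ 'd"
  assumes w: "\<And>j. w $ j > 0" and "u > 0"
    and C: "admissible_plan_C n z (weighted_simplex w u)"
    and B: "\<And>j. u \<ge> w $ j \<Longrightarrow> \<not> int n dvd 2 * \<lfloor>u / w $ j\<rfloor> * z $ j"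
    and "v \<noteq> 0"
    and \<alpha>: "\<And>j. j \<in> supp v \<Longrightarrow> w $ j \<le> \<alpha>"
    and norm: "lattice_norm w v + \<alpha> \<le> 2 * u"
  shows "\<not> int n dvd dot v z"
proof -
  let ?p = "\<lambda>v. (\<chi> j. max 0 (- v $ j)) :: int ^ 'd"
  have "lattice_norm w (?p v + ?p (- v)) = lattice_norm w (?p v) + lattice_norm w (?p (- v))"
    by (intro lattice_norm_add) auto
  moreover have "lattice_norm w (?p v + ?p (- v)) = lattice_norm w v"
    unfolding lattice_norm_eq by (intro sum.cong arg_cong2 [of _ _ _ _ "(*)"]) auto
  moreover obtain i where "i \<in> supp v"
    using \<open>v \<noteq> 0\<close> by (auto simp: supp_def vec_eq_iff)
  then have "\<alpha> > 0"
    using \<alpha> [of i] w [of i] by linarith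
  ultimately consider "lattice_norm w v - u \<le> lattice_norm w (?p v)"
    | "lattice_norm w (- v) - u \<le> lattice_norm w (?p (- v))"
    using norm unfolding lattice_norm_minus by linarith
  then show ?thesis
  proof cases
    case 1
    then show ?thesis
      by (intro not_dvd_of_large_negative_part [OF assms])
  next
    case 2
    then have "\<not> int n dvd dot (- v) z"
      using \<open>v \<noteq> 0\<close> norm \<alpha>
      by (intro not_dvd_of_large_negative_part [OF w \<open>u > 0\<close> C B, where \<alpha> = \<alpha>])
        (auto simp: supp_def)
    then show ?thesis by (simp add: dot_minus)
  qed
qed

section \<open>Necessity of the conditions, and odd moduli\<close>

text \<open>Sign changes preserve absolute values, so distinct \<open>h\<close> and
  \<open>h'\<close> give distinct points of the mirrored set.\<close>

lemma plan_A_imp_plan_C: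
  assumes "admissible_plan_A n z \<Lambda>"
  shows "admissible_plan_C n z \<Lambda>"
  unfolding admissible_plan_C_def
proof (intro ballI impI)
  fix h h' \<sigma> assume *: "h \<in> \<Lambda>" "h' \<in> \<Lambda>" "\<sigma> \<in> sign_changes h" "h \<noteq> h'"
  have "\<sigma> h \<noteq> int_vec h'"
  proof
    assume eq: "\<sigma> h = int_vec h'"
    have "h $ j = h' $ j" for j
      using abs_sign_change [OF *(3), of h j] by (simp add: eq int_vec_def)
    with *(4) show False by (simp add: vec_eq_iff)
  qed
  moreover have "\<sigma> h \<in> mirrored \<Lambda>" "int_vec h' \<in> mirrored \<Lambda>"
    using * int_vec_in_sign_changes [of h'] unfolding mirrored_def by blast+
  ultimately show "\<not> [dot (\<sigma> h) z = dot (int_vec h') z] (mod int n)"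
    using assms unfolding admissible_plan_A_def by blast
qed

text \<open>Provides the nonzero axis point of the ball on which condition (b) is tested.\<close>

lemma maximal_axis:
  fixes w :: "real ^ 'd"
  assumes "w $ j > 0" and "w $ j \<le> u"
  shows "\<lfloor>u / w $ j\<rfloor> \<ge> 1" and "lattice_norm w (axis j \<lfloor>u / w $ j\<rfloor>) \<le> u"
proof -
  show ge: "\<lfloor>u / w $ j\<rfloor> \<ge> 1"
    using assms by (simp add: le_floor_iff)
  have "w $ j * real_of_int \<lfloor>u / w $ j\<rfloor> \<le> w $ j * (u / w $ j)"
    using assms by (intro mult_left_mono) auto
  then show "lattice_norm w (axis j \<lfloor>u / w $ j\<rfloor>) \<le> u"
    using ge assms by (simp add: lattice_norm_axis)
qed

text \<open>The maximal axis point and its negative are distinct points of the ball, and their dot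
  products with \<open>z\<close> differ by the number in condition (b).\<close>

lemma plan_A_axis:
  fixes w :: "real ^ 'd"
  assumes A: "admissible_plan_A n z (weighted_simplex w u)" and "w $ j > 0" and "w $ j \<le> u"
  shows "\<not> [2 * \<lfloor>u / w $ j\<rfloor> * z $ j = 0] (mod int n)"
proof -
  let ?x = "axis j \<lfloor>u / w $ j\<rfloor> :: int ^ 'd"
  have "?x $ j \<noteq> (- ?x) $ j"
    using maximal_axis(1) [OF assms(2,3)] by (simp del: one_le_floor)
  then have "?x \<noteq> - ?x"
    by metis
  moreover have "?x \<in> mirrored (weighted_simplex w u)" "- ?x \<in> mirrored (weighted_simplex w u)"
    using maximal_axis(2) [OF assms(2,3)] by (simp_all add: mirrored_weighted_simplex)
  ultimately have "\<not> [dot ?x z = dot (- ?x) z] (mod int n)"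
    using A unfolding admissible_plan_A_def by blast
  then show ?thesis
    by (simp add: cong_iff_dvd_diff dot_axis dot_minus mult_ac)
qed

text \<open>Plan C for the maximal axis point and the origin gives the claim without the factor 2,
  which is invertible modulo an odd \<open>n\<close>.\<close>

lemma plan_C_odd_axis:
  fixes w :: "real ^ 'd"
  assumes C: "admissible_plan_C n z (weighted_simplex w u)" and "odd n"
    and "w $ j > 0" and "w $ j \<le> u"
  shows "\<not> [2 * \<lfloor>u / w $ j\<rfloor> * z $ j = 0] (mod int n)"
proof -
  let ?x = "axis j \<lfloor>u / w $ j\<rfloor> :: int ^ 'd"
  have "lattice_norm w 0 \<le> u"
    using assms(3,4) by (simp add: lattice_norm_eq)
  moreover have "\<bar>?x $ j\<bar> \<noteq> (0 :: int ^ 'd) $ j"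
    using maximal_axis(1) [OF assms(3,4)] by (simp del: one_le_floor)
  ultimately have "\<not> int n dvd dot (?x - 0) z"
    using maximal_axis(2) [OF assms(3,4)] by (intro plan_C_not_dvd [OF C, where i = j]) auto
  moreover have "coprime (int n) 2"
    using \<open>odd n\<close> by simp
  ultimately show ?thesis
    by (simp add: cong_0_iff dot_axis mult.assoc coprime_dvd_mult_right_iff)
qed

theorem proposition4p7:
  fixes w :: "real ^ 'd" and u :: real and n :: nat and z :: "int ^ 'd"
    and \<Lambda> :: "(nat ^ 'd) set"
    and cond_b cond_c :: bool
  assumes "\<And>j. w $ j > 0" and "u > 0" and "n \<ge> 1"
  defines "\<Lambda> \<equiv> weighted_simplex w u"
    and "cond_b \<equiv> (\<forall>j. u \<ge> w $ j \<longrightarrow> \<not> [2 * \<lfloor>u / w $ j\<rfloor> * z $ j = 0] (mod int n))"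
    and "cond_c \<equiv> (\<forall>h \<in> mirrored \<Lambda>. \<forall>h' \<in> mirrored \<Lambda>.
           h' \<noteq> h \<and>
           weighted_l1_norm w (real_vec h) + weighted_l1_norm w (real_vec h')
             > 2 * u - max_weight w h h' \<longrightarrow>
           \<not> [dot h' z = dot h z] (mod int n))"
  shows "(admissible_plan_A n z \<Lambda> \<longleftrightarrow> admissible_plan_C n z \<Lambda> \<and> cond_b \<and> cond_c)
       \<and> (odd n \<longrightarrow> admissible_plan_C n z \<Lambda> \<longrightarrow> cond_b)"
proof -
  note w = assms(1) and \<Lambda> = \<Lambda>_def and b = cond_b_def and c = cond_c_def
  have "admissible_plan_A n z \<Lambda>" if C: "admissible_plan_C n z \<Lambda>" and cond_b and cond_c
    unfolding admissible_plan_A_def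
  proof (intro ballI impI)
    fix h h' assume h: "h \<in> mirrored \<Lambda>" and h': "h' \<in> mirrored \<Lambda>" and "h \<noteq> h'"
    show "\<not> [dot h z = dot h' z] (mod int n)"
    proof (cases "lattice_norm w h + lattice_norm w h' > 2 * u - max_weight w h h'")
      case True
      with h h' \<open>h \<noteq> h'\<close> \<open>cond_c\<close> show ?thesis
        unfolding c by (metis cong_sym)
    next
      case False
      have B: "\<not> int n dvd 2 * \<lfloor>u / w $ j\<rfloor> * z $ j" if "u \<ge> w $ j" for j
        using \<open>cond_b\<close> that unfolding b cong_0_iff by blast
      have "\<not> int n dvd dot (h - h') z"
      \<comment> \<open>The role of \<alpha> is played by \<open>max_weight w h h'\<close>, a
        genuine maximum because \<open>h \<noteq> h'\<close> excludes two empty supports. The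
        triangle inequality carries the bound on the total norm over to
        \<open>h - h'\<close>.\<close>
      proof (rule not_dvd_of_small_norm [OF w \<open>u > 0\<close> C [unfolded \<Lambda>] B])
        show "h - h' \<noteq> 0"
          using \<open>h \<noteq> h'\<close> by simp
        show "w $ j \<le> max_weight w h h'" if "j \<in> supp (h - h')" for j
          using that supp_diff_subset [of h h'] unfolding max_weight_def by (intro Max_ge) auto
        show "lattice_norm w (h - h') + max_weight w h h' \<le> 2 * u"
          using False lattice_norm_triangle [OF w, of h h'] by linarith
      qed
      then show ?thesis
        by (simp add: cong_iff_dvd_diff dot_diff)
    qed
  qed
  moreover have "admissible_plan_C n z \<Lambda> \<and> cond_b \<and> cond_c" if A: "admissible_plan_A n z \<Lambda>"
  proof (intro conjI)
    show "admissible_plan_C n z \<Lambda>"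
      using A by (rule plan_A_imp_plan_C)
    show cond_b
      using plan_A_axis [OF A [unfolded \<Lambda>] w] unfolding b by blast
    show cond_c
      using A unfolding c admissible_plan_A_def by blast
  qed
  moreover have cond_b if "odd n" and C: "admissible_plan_C n z \<Lambda>"
    using plan_C_odd_axis [OF C [unfolded \<Lambda>] \<open>odd n\<close> w] unfolding b by blast
  ultimately show ?thesis by blast
qed

end
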